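(* Let $b,c$ be positive integers, and let $(x_m)_{m\in\mathbb{Z}}$ be the elements of the field $\mathbb{Q}(x_1,x_2)$ of rational functions in two indeterminates $x_1,x_2$ determined by the recurrence relations $$x_{m-1}x_{m+1}=\begin{cases} x_m^b+1 & \text{if } m \text{ is odd},\\ x_m^c+1 & \text{if } m \text{ is even},\end{cases}\qquad m\in\mathbb{Z}.$$ Then for any $m\in\mathbb{Z}$, $$\{x_k : k\in\mathbb{Z}\}\subset \mathbb{N}[x_m^{\pm 1},x_{m+1}^{\pm 1}].$$
   Context: The elements $x_m$, $m \in \mathbb{Z}$, are the cluster variables of the coefficient-free rank two cluster algebra $\mathcal{A}(b,c)$, which is the subring of $\mathbb{Q}(x_1,x_2)$ they generate; the pairs $(x_m,x_{m+1})$ are its clusters. Here $\mathbb{N}=\{0,1,2,\dots\}$, and $\mathbb{N}[x_m^{\pm1},x_{m+1}^{\pm1}]$ denotes the set of elements of $\mathbb{Q}(x_1,x_2)$ that are finite $\mathbb{N}$-linear combinations of Laurent monomials $x_m^{p}x_{m+1}^{q}$ with $p,q\in\mathbb{Z}$ (substraction-free Laurent polynomials in $x_m,x_{m+1}$). *)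

theory Defs
  imports "HOL-Computational_Algebra.Computational_Algebra"
begin

text \<open>
  The field of rational functions in two indeterminates over the rationals, realised as the
  fraction field of \<open>\<rat>[x\<^sub>1][x\<^sub>2]\<close>.
\<close>

type_synonym ratfun2 = "rat poly poly fract"

definition X1 :: ratfun2 where
  "X1 = to_fract [:[:0, 1:]:]"

definition X2 :: ratfun2 where
  "X2 = to_fract [:0, 1:]"

text \<open>
  The recurrence together with the initial values \<open>x\<^sub>1\<close>, \<open>x\<^sub>2\<close> determines the sequence uniquely;
  this is \<open>ex1_cluster_variables\<close> below.
\<close>

definition cluster_variables :: "nat \<Rightarrow> nat \<Rightarrow> (int \<Rightarrow> ratfun2) \<Rightarrow> bool" where
  "cluster_variables b c x \<longleftrightarrow>
     x 1 = X1 \<and> x 2 = X2 \<and>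
     (\<forall>m. x (m - 1) * x (m + 1) = (if odd m then x m ^ b + 1 else x m ^ c + 1))"

definition subfree_laurent :: "ratfun2 \<Rightarrow> ratfun2 \<Rightarrow> ratfun2 set" where
  "subfree_laurent u v =
     {f. \<exists>(S :: (int \<times> int) set) (a :: int \<Rightarrow> int \<Rightarrow> nat). finite S \<and>
           f = (\<Sum>(p, q)\<in>S. of_nat (a p q) * (u powi p * v powi q))}"

text \<open>
  The library orders \<open>ratfun2\<close> as a linearly ordered field in which both indeterminates are
  positive, so no member of the sequence vanishes and the recurrence can be solved in both
  directions.
\<close>

lemma X1_pos: "X1 > 0" and X2_pos: "X2 > 0"
proof -
  have "[:[:0, 1:]:] > (0 :: rat poly poly)" "[:0, 1:] > (0 :: rat poly poly)"
    by (simp_all add: less_poly_def pos_poly_pCons pos_poly_def)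
  then show "X1 > 0" "X2 > 0"
    by (simp_all add: X1_def X2_def to_fract_def zero_less_Fract_iff)
qed

lemma cluster_variables_pos:
  assumes "cluster_variables b c x"
  shows "x m > 0"
proof -
  have rec: "x (m - 1) * x (m + 1) = (if odd m then x m ^ b + 1 else x m ^ c + 1)" for m
    using assms by (simp add: cluster_variables_def)
  have up: "x (m + 1) > 0" if "x (m - 1) > 0" "x m > 0" for m
  proof -
    have "x (m - 1) * x (m + 1) > 0"
      unfolding rec using that by (simp add: add_pos_pos)
    with that show ?thesis by (simp add: zero_less_mult_iff)
  qed
  have down: "x (m - 1) > 0" if "x (m + 1) > 0" "x m > 0" for m
  proof -
    have "x (m - 1) * x (m + 1) > 0"
      unfolding rec using that by (simp add: add_pos_pos)
    with that show ?thesis by (simp add: zero_less_mult_iff)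
  qed
  have "x m > 0 \<and> x (m + 1) > 0"
  proof (induction m rule: int_induct[where k = 1])
    case base
    then show ?case using assms X1_pos X2_pos by (simp add: cluster_variables_def)
  next
    case (step1 i)
    then show ?case using up[of "i + 1"] by simp
  next
    case (step2 i)
    then show ?case using down[of i] by simp
  qed
  then show ?thesis ..
qed

lemma ex1_cluster_variables: "\<exists>!x. cluster_variables b c x"
proof (rule ex_ex1I)
  define r where "r m y = (if odd m then y ^ b + 1 else y ^ c + 1)" for m :: int and y :: ratfun2
  have r_pos: "r m y > 0" if "y > 0" for m y
    using that by (simp add: r_def add_pos_pos)
  define f where "f = rec_nat (X1, X2) (\<lambda>n (u, v). (v, r (int n + 2) v / u))"
  define g where "g = rec_nat (X1, X2) (\<lambda>n (u, v). (r (1 - int n) u / v, u))"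
  have f0: "f 0 = (X1, X2)" and g0: "g 0 = (X1, X2)"
    by (simp_all add: f_def g_def)
  have fS: "f (Suc n) = (snd (f n), r (int n + 2) (snd (f n)) / fst (f n))"
    and gS: "g (Suc n) = (r (1 - int n) (fst (g n)) / snd (g n), fst (g n))" for n
    by (simp_all add: f_def g_def split: prod.splits)
  have fpos: "fst (f n) > 0 \<and> snd (f n) > 0" for n
    by (induction n) (auto simp: f0 fS X1_pos X2_pos r_pos)
  have gpos: "fst (g n) > 0 \<and> snd (g n) > 0" for n
    by (induction n) (auto simp: g0 gS X1_pos X2_pos r_pos)
  define x where "x m = (if m \<ge> 1 then fst (f (nat (m - 1))) else fst (g (nat (1 - m))))" for m
  have xf: "x (int n + 1) = fst (f n)" for n
    by (simp add: x_def)
  have xg: "x (1 - int n) = fst (g n)" for n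
    by (cases n) (simp_all add: x_def f0 g0 nat_add_distrib)
  have main: "x (m - 1) * x (m + 1) = r m (x m)" for m
  proof (cases "m \<ge> 2")
    case True
    define n where "n = nat (m - 2)"
    have m: "m = int n + 2" using True by (simp add: n_def)
    have "x (m - 1) = fst (f n)" "x m = snd (f n)" "x (m + 1) = r m (snd (f n)) / fst (f n)"
      using xf[of n] xf[of "Suc n"] xf[of "Suc (Suc n)"] by (simp_all add: m fS algebra_simps)
    then show ?thesis using fpos[of n] by simp
  next
    case False
    define n where "n = nat (1 - m)"
    have m: "m = 1 - int n" using False by (simp add: n_def)
    have a: "x m = fst (g n)" "x (m - 1) = r m (fst (g n)) / snd (g n)"
      using xg[of n] xg[of "Suc n"] by (simp_all add: m gS algebra_simps)
    have "x (m + 1) = snd (g n)"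
    proof (cases n)
      case 0
      then show ?thesis using xf[of 1] by (simp add: m g0 fS f0)
    next
      case (Suc k)
      then show ?thesis using xg[of k] by (simp add: m gS)
    qed
    with a show ?thesis using gpos[of n] by simp
  qed
  have "x 1 = X1" "x 2 = X2"
    using xf[of 0] xf[of 1] by (simp_all add: fS f0)
  with main have "cluster_variables b c x"
    by (simp add: cluster_variables_def r_def)
  then show "\<exists>x. cluster_variables b c x" by blast
next
  fix x y assume xy: "cluster_variables b c x" "cluster_variables b c y"
  have nz: "x m \<noteq> 0" "y m \<noteq> 0" for m
    using cluster_variables_pos[OF xy(1), of m] cluster_variables_pos[OF xy(2), of m] by auto
  have rec: "x (m - 1) * x (m + 1) = y (m - 1) * y (m + 1)" if "x m = y m" for m
    using xy that by (simp add: cluster_variables_def)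
  have "x m = y m \<and> x (m + 1) = y (m + 1)" for m
  proof (induction m rule: int_induct[where k = 1])
    case base
    then show ?case using xy by (simp add: cluster_variables_def)
  next
    case (step1 i)
    then show ?case using rec[of "i + 1"] nz(2)[of i] by simp
  next
    case (step2 i)
    then show ?case using rec[of i] nz(2)[of "i + 1"] by simp
  qed
  then show "x = y" by blast
qed

end

theory Submission imports Defs begin

text \<open>
  Every cluster variable other than \<open>u\<close> and \<open>v\<close> is a sum of Laurent monomials \<open>u\<^sup>i v\<^sup>j\<close>, where
  \<open>(u, v) = (x\<^sub>m, x\<^bsub>m+1\<^esub>)\<close>, that runs over certain markings of a word in two letters \<open>H\<close> and \<open>V\<close>.
  Write \<open>b\<close> for the exponent attached to \<open>u\<close> and \<open>c\<close> for the one attached to \<open>v\<close>.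
  A letter \<open>H\<close> contributes \<open>u\<^sup>-\<^sup>1\<close>, a letter \<open>V\<close> contributes \<open>v\<^sup>-\<^sup>1\<close>, a mark on \<open>H\<close> an additional
  \<open>v\<^sup>c\<close> and a mark on \<open>V\<close> an additional \<open>u\<^sup>b\<close>; the admissible markings are the compatible ones,
  modelled on the compatible pairs of sets of horizontal and vertical edges of a Dyck path.
  Such a sum, \<open>word_sum\<close>, has no negative coefficients by its form.

  What has to be proved is that word sums survive a change of cluster.  Let \<open>u u' = v\<^sup>c + 1\<close>.
  The key identity (\<open>word_sum_mutation\<close>) says that, when all runs of \<open>V\<close> have length at
  most \<open>b\<close>, the sum of the word \<open>H V\<^bsup>l\<^esup> H V\<^bsup>l'\<^esup> \<dots>\<close> in the cluster \<open>(v, u')\<close> is the sum of the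
  word \<open>H\<^bsup>b-l\<^esup> V H\<^bsup>b-l'\<^esup> V \<dots>\<close> in the cluster \<open>(u, v)\<close>.  Exchanging the two letters and
  reversing the word exchanges \<open>u\<close> and \<open>v\<close> (\<open>word_sum_flip\<close>), so this amounts to replacing
  \<open>u\<close> by \<open>u'\<close> for the words
  \<open>H\<^bsup>n\<^esup> V H\<^bsup>n'\<^esup> V \<dots>\<close> and \<open>\<dots> H\<^bsup>b-n'\<^esup> V H\<^bsup>b-n\<^esup> V\<close> (\<open>word_sum_blocks\<close>).

  That replacement holds for each fixed set of marked \<open>V\<close>s on one side and the complementary
  set on the other.  Read \<open>H\<close> as an opening parenthesis and a marked \<open>V\<close> as \<open>b\<close> closing ones.
  Compatibility turns out to depend on the matched parentheses alone: if \<open>T\<close> is the set of matched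
  pairs whose \<open>H\<close> is marked, each pair in \<open>T\<close> has to enclose at least \<open>c\<close> letters \<open>V\<close> for every
  pair of \<open>T\<close> nested in it, itself included.  A marked \<open>V\<close> immediately consumes the \<open>n\<close> letters
  \<open>H\<close> of its own block, and pairs within a block enclose no \<open>V\<close>; what is left is \<open>b - n\<close> closing
  parentheses for a block with a marked \<open>V\<close> and \<open>n\<close> opening ones otherwise.  Passing to the other
  word with complemented marks and opposite direction of reading gives exactly the same
  parentheses.  Unmatched ones agree as well: an unmatched \<open>H\<close> may be marked freely and
  contributes \<open>(1 + v\<^sup>c) / u = u'\<close>, an unmatched closing parenthesis contributes \<open>u\<close>, and these
  two roles are exchanged together with \<open>u\<close> and \<open>u'\<close>.  Formally the two sums are produced by a
  stack that absorbs the word from one end or from the other, and both are compared with a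
  pairing between a left stack and a right stack (\<open>absorb_blocks_pairing\<close>).

  To move from the cluster of \<open>x\<^sub>k\<close> down to \<open>(x\<^sub>m, x\<^bsub>m+1\<^esub>)\<close>, start with the word \<open>H\<close>, whose sum is
  the next variable \<open>(v\<^sup>c + 1) / u\<close>, and mutate.  The words met on the way must begin with \<open>H\<close>
  and have short enough runs of \<open>V\<close>.  This is secured by families of words closed under mutation
  (\<open>ex_closed_family\<close>).  Only when \<open>b c \<le> 3\<close>, where the sequence is periodic, does a word occur
  that does not begin with \<open>H\<close>: it is \<open>V\<close>, and its sum is simply the preceding variable.
  Variables \<open>x\<^sub>k\<close> with \<open>k < m\<close> are reached by running the sequence backwards.
\<close>

section \<open>Compatible markings of words\<close>

datatype letter = H | V

type_synonym marking = "(letter \<times> bool) list"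

abbreviation letters :: "letter \<Rightarrow> marking \<Rightarrow> nat" where
  "letters x t \<equiv> count_list (map fst t) x"

abbreviation marks :: "letter \<Rightarrow> marking \<Rightarrow> nat" where
  "marks x t \<equiv> count_list t (x, True)"

text \<open>
  The value \<open>f + c * marks H p - letters V p\<close> is what remains, after the prefix \<open>p\<close>, of a debt \<open>f\<close>
  that each \<open>V\<close> lowers by one and each marked \<open>H\<close> raises by \<open>c\<close>; \<open>reached\<close> says that the debt is
  paid off at some point of \<open>s\<close>.
\<close>
definition reached :: "nat \<Rightarrow> nat \<Rightarrow> marking \<Rightarrow> bool" where
  "reached c f s \<longleftrightarrow> (\<exists>p q. s = p @ q \<and> letters V p \<ge> f + c * marks H p)"

text \<open>
  For a marked \<open>H\<close> before and a marked \<open>V\<close> after \<open>s\<close>: either the debt of this \<open>H\<close> is paid off within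
  \<open>s\<close>, or, reading from right to left, that of this \<open>V\<close> is.
\<close>
definition separated :: "nat \<Rightarrow> nat \<Rightarrow> marking \<Rightarrow> bool" where
  "separated b c s \<longleftrightarrow>
     reached c c s \<or> (\<exists>p q. s = p @ q \<and> letters H q \<ge> b * (marks V q + 1))"

definition compatible :: "nat \<Rightarrow> nat \<Rightarrow> marking \<Rightarrow> bool" where
  "compatible b c t \<longleftrightarrow>
     (\<forall>r s r'. t = r @ (H, True) # s @ (V, True) # r' \<longrightarrow> separated b c s)"

definition markings :: "letter list \<Rightarrow> marking set" where
  "markings w = {t. map fst t = w}"

definition word_sum :: "nat \<Rightarrow> nat \<Rightarrow> 'a::field \<Rightarrow> 'a \<Rightarrow> letter list \<Rightarrow> 'a" where
  "word_sum b c u v w =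
     (\<Sum>t | t \<in> markings w \<and> compatible b c t.
        u powi (int (b * marks V t) - int (letters H t)) *
        v powi (int (c * marks H t) - int (letters V t)))"

lemma markings_Nil: "markings [] = {[]}"
  by (auto simp: markings_def)

lemma markings_Cons:
  "markings (x # w) = (#) (x, False) ` markings w \<union> (#) (x, True) ` markings w"
proof (intro equalityI subsetI)
  fix t assume "t \<in> markings (x # w)"
  then obtain m s where "t = (x, m) # s" "s \<in> markings w"
    by (auto simp: markings_def)
  then show "t \<in> (#) (x, False) ` markings w \<union> (#) (x, True) ` markings w"
    by (cases m) auto
qed (auto simp: markings_def)

lemma finite_markings: "finite (markings w)"
  by (induction w) (simp_all add: markings_Nil markings_Cons)

lemma sum_markings_Cons:
  "(\<Sum>t\<in>markings (x # w). f t) = (\<Sum>t\<in>markings w. f ((x, False) # t) + f ((x, True) # t))"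
proof -
  have "(\<Sum>t\<in>markings (x # w). f t) =
      (\<Sum>t\<in>(#) (x, False) ` markings w. f t) + (\<Sum>t\<in>(#) (x, True) ` markings w. f t)"
    unfolding markings_Cons
    by (rule sum.union_disjoint) (auto simp: finite_markings)
  also have "\<dots> = (\<Sum>t\<in>markings w. f ((x, False) # t)) + (\<Sum>t\<in>markings w. f ((x, True) # t))"
    by (simp add: sum.reindex)
  finally show ?thesis
    by (simp add: sum.distrib)
qed

text \<open>
  Different members of \<open>T\<close> may give the same monomial, so coefficients count fibres.
\<close>
lemma subfree_laurent_monomials:
  assumes "finite T"
  shows "(\<Sum>t\<in>T. u powi (f t) * v powi (g t)) \<in> subfree_laurent u v"
proof -
  define a where "a p q = card {t \<in> T. (f t, g t) = (p, q)}" for p q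
  have "(\<Sum>t\<in>T. u powi (f t) * v powi (g t)) =
      (\<Sum>e\<in>(\<lambda>t. (f t, g t)) ` T. \<Sum>t | t \<in> T \<and> (f t, g t) = e. u powi (f t) * v powi (g t))"
    by (rule sum.image_gen[OF assms])
  also have "\<dots> = (\<Sum>(p, q)\<in>(\<lambda>t. (f t, g t)) ` T. of_nat (a p q) * (u powi p * v powi q))"
  proof (rule sum.cong[OF refl], clarify)
    fix t assume "t \<in> T"
    have "(\<Sum>s | s \<in> T \<and> (f s, g s) = (f t, g t). u powi (f s) * v powi (g s)) =
        (\<Sum>s | s \<in> T \<and> (f s, g s) = (f t, g t). u powi (f t) * v powi (g t))"
      by (rule sum.cong) auto
    then show "(\<Sum>s | s \<in> T \<and> (f s, g s) = (f t, g t). u powi (f s) * v powi (g s)) =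
        of_nat (a (f t) (g t)) * (u powi (f t) * v powi (g t))"
      by (simp add: a_def)
  qed
  finally show ?thesis
    using assms unfolding subfree_laurent_def by blast
qed

lemma word_sum_subfree: "word_sum b c u v w \<in> subfree_laurent u v"
  unfolding word_sum_def
  by (rule subfree_laurent_monomials) (simp add: finite_markings)

section \<open>Exchanging the two letters\<close>

fun other :: "letter \<Rightarrow> letter" where
  "other H = V"
| "other V = H"

lemma other_other [simp]: "other (other x) = x"
  by (cases x) simp_all

lemma other_comp_other [simp]: "other \<circ> other = id"
  by (simp add: fun_eq_iff)

definition flip :: "marking \<Rightarrow> marking" where
  "flip t = rev (map (map_prod other id) t)"

lemma flip_flip [simp]: "flip (flip t) = t"
  by (simp add: flip_def rev_map prod.map_comp map_prod.comp map_prod.id)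

lemma flip_append: "flip (s @ t) = flip t @ flip s"
  by (simp add: flip_def)

lemma flip_Cons: "flip ((x, m) # t) = flip t @ [(other x, m)]"
  by (simp add: flip_def)

lemma letters_flip: "letters x (flip t) = letters (other x) t"
proof (induction t)
  case (Cons a t)
  obtain y m where a: "a = (y, m)" by fastforce
  show ?case unfolding a flip_Cons using Cons by (cases x; cases y) simp_all
qed (simp add: flip_def)

lemma marks_flip: "marks x (flip t) = marks (other x) t"
proof (induction t)
  case (Cons a t)
  obtain y m where a: "a = (y, m)" by fastforce
  show ?case unfolding a flip_Cons using Cons by (cases x; cases y) simp_all
qed (simp add: flip_def)

lemma separated_flip:
  assumes "separated b c s"
  shows "separated c b (flip s)"
  using assms unfolding separated_def reached_def
proof (elim disjE exE conjE)
  fix p q assume "s = p @ q" "c + c * marks H p \<le> letters V p"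
  then have "flip s = flip q @ flip p" "c * (marks V (flip p) + 1) \<le> letters H (flip p)"
    by (simp_all add: flip_append letters_flip marks_flip)
  then show "(\<exists>p q. flip s = p @ q \<and> b + b * marks H p \<le> letters V p) \<or>
      (\<exists>p q. flip s = p @ q \<and> c * (marks V q + 1) \<le> letters H q)"
    by blast
next
  fix p q assume "s = p @ q" "b * (marks V q + 1) \<le> letters H q"
  then have "flip s = flip q @ flip p" "b + b * marks H (flip q) \<le> letters V (flip q)"
    by (simp_all add: flip_append letters_flip marks_flip)
  then show "(\<exists>p q. flip s = p @ q \<and> b + b * marks H p \<le> letters V p) \<or>
      (\<exists>p q. flip s = p @ q \<and> c * (marks V q + 1) \<le> letters H q)"
    by blast
qed

lemma compatible_flip:
  assumes "compatible b c t"
  shows "compatible c b (flip t)"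
  unfolding compatible_def
proof (intro allI impI)
  fix r s r' assume "flip t = r @ (H, True) # s @ (V, True) # r'"
  then have "flip (flip t) = flip r' @ (H, True) # flip s @ (V, True) # flip r"
    by (simp add: flip_append flip_Cons)
  then have "separated b c (flip s)"
    using assms unfolding compatible_def flip_flip by blast
  then show "separated c b s"
    using separated_flip by fastforce
qed

lemma flip_markings: "t \<in> markings w \<Longrightarrow> flip t \<in> markings (rev (map other w))"
  by (auto simp: markings_def flip_def rev_map)

text \<open>
  The definition of compatibility treats a marked \<open>H\<close> and a marked \<open>V\<close> alike up to the direction
  of reading.  This symmetry lets one identity, proved with the marks on \<open>V\<close> kept fixed, serve in
  both kinds of clusters.
\<close>
lemma word_sum_flip: "word_sum b c u v w = word_sum c b v u (rev (map other w))"
  unfolding word_sum_def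
proof (rule sum.reindex_bij_witness[of _ flip flip], goal_cases)
  case (4 t)
  then show ?case
    using compatible_flip[of c b t] flip_markings[of t "rev (map other w)"] by (simp add: rev_map)
next
  case (2 t)
  then show ?case
    using compatible_flip[of b c t] flip_markings[of t w] by simp
qed (simp_all add: letters_flip marks_flip mult.commute)

section \<open>Compatibility by a stack\<close>

text \<open>
  A marked word is absorbed from its right end.  Parentheses that find their partner disappear, and
  what remains are the closing parentheses that are still open to the left.  The state \<open>(z, zs)\<close>
  lists, from left to right, the credits collected in front of the first of them, between
  consecutive ones, and behind the last one; so \<open>length zs\<close> is their number.  The credit is the
  number of letters \<open>V\<close> minus \<open>c\<close> for each marked \<open>H\<close>.  The credits are natural numbers
  because a mark on \<open>H\<close> is compatible only where the credit up to its partner is at least \<open>c\<close>.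
  Without a closing parenthesis left, a further \<open>H\<close> is unrestricted, and the credit, which is
  never consulted again, is kept as it is.
\<close>

fun contract :: "nat \<Rightarrow> nat \<times> nat list \<Rightarrow> nat \<times> nat list" where
  "contract e (z, []) = (z, [])"
| "contract e (z, z' # zs) = (z + z' - e, zs)"

definition open_level :: "nat \<times> nat list \<Rightarrow> nat \<times> nat list" where
  "open_level = (\<lambda>(z, zs). (0, z # zs))"

fun stack :: "nat \<Rightarrow> nat \<Rightarrow> marking \<Rightarrow> nat \<times> nat list" where
  "stack b c [] = (0, [])"
| "stack b c ((H, m) # t) = contract (if m then c else 0) (stack b c t)"
| "stack b c ((V, m) # t) =
     (open_level ^^ (if m then b else 0)) (apfst Suc (stack b c t))"

lemma length_open_level: "length (snd ((open_level ^^ n) st)) = n + length (snd st)"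
  by (induction n) (simp_all add: open_level_def case_prod_beta)

text \<open>
  The total credit in front of the closing parenthesis with index \<open>j\<close>, counting from zero.
\<close>
definition depth_sum :: "nat \<Rightarrow> nat \<times> nat list \<Rightarrow> nat" where
  "depth_sum j st = fst st + sum_list (take j (snd st))"

lemma depth_sum_open_level:
  "depth_sum j ((open_level ^^ n) st) = (if j < n then 0 else depth_sum (j - n) st)"
proof (induction n arbitrary: j)
  case (Suc n)
  then show ?case
    by (cases j) (simp_all add: open_level_def case_prod_beta depth_sum_def)
qed simp

text \<open>
  A race between two quantities, read from left to right: the debt \<open>f\<close> as in \<open>reached\<close>, and the
  number \<open>g\<close> of unmatched opening parentheses.  The debt has to be paid off before \<open>g\<close> drops
  to zero.  The start \<open>f = c\<close>, \<open>g = 1\<close> is the situation just after a marked \<open>H\<close>.  The general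
  values make the race a recursion on the word.
\<close>
definition wins :: "nat \<Rightarrow> nat \<Rightarrow> nat \<Rightarrow> nat \<Rightarrow> marking \<Rightarrow> bool" where
  "wins b c f g t \<longleftrightarrow> (\<forall>s r. t = s @ (V, True) # r \<longrightarrow>
     reached c f s \<or> g + letters H s > b * (marks V s + 1))"

lemma reached_0: "reached c 0 s"
  unfolding reached_def by (rule exI[of _ "[]"]) simp

lemma not_reached_Nil: "f > 0 \<Longrightarrow> \<not> reached c f []"
  by (simp add: reached_def)

lemma reached_append: "reached c f s \<Longrightarrow> reached c f (s @ r)"
  unfolding reached_def by (metis append.assoc)

lemma ex_prefix_Cons_iff:
  assumes "\<not> P []"
  shows "(\<exists>p q. a # s = p @ q \<and> P p) \<longleftrightarrow> (\<exists>p q. s = p @ q \<and> P (a # p))"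
  using assms by (auto simp: Cons_eq_append_conv)

lemma reached_H:
  "f > 0 \<Longrightarrow> reached c f ((H, m) # s) \<longleftrightarrow> reached c (f + (if m then c else 0)) s"
  unfolding reached_def by (subst ex_prefix_Cons_iff) (auto simp: algebra_simps)

lemma reached_V: "f > 0 \<Longrightarrow> reached c f ((V, m) # s) \<longleftrightarrow> reached c (f - 1) s"
  unfolding reached_def by (subst ex_prefix_Cons_iff; cases f; simp)

lemma all_split_Cons:
  "(\<forall>s r. a # t = s @ x # r \<longrightarrow> P s) \<longleftrightarrow>
     (a = x \<longrightarrow> P []) \<and> (\<forall>s r. t = s @ x # r \<longrightarrow> P (a # s))"
  by (auto simp: Cons_eq_append_conv)

lemma wins_0: "wins b c 0 g t"
  unfolding wins_def by (simp add: reached_0)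

lemma wins_H:
  "f > 0 \<Longrightarrow> wins b c f g ((H, m) # t) \<longleftrightarrow> wins b c (f + (if m then c else 0)) (g + 1) t"
  unfolding wins_def all_split_Cons by (simp add: reached_H)

lemma wins_V:
  assumes "f > 0"
  shows "wins b c f g ((V, m) # t) \<longleftrightarrow>
     (m \<longrightarrow> g > b) \<and> wins b c (f - 1) (g - (if m then b else 0)) t"
proof (cases "m \<longrightarrow> g > b")
  case True
  define d where "d = g - (if m then b else 0)"
  have g: "g = d + (if m then b else 0)"
    using True by (auto simp: d_def)
  from True assms show ?thesis
    unfolding wins_def all_split_Cons d_def[symmetric]
    by (cases m) (simp_all add: reached_V not_reached_Nil g)
next
  case False
  with assms show ?thesis
    unfolding wins_def all_split_Cons by (simp add: not_reached_Nil)
qed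

lemma compatible_Cons_H:
  "compatible b c ((H, m) # t) \<longleftrightarrow>
     compatible b c t \<and> (m \<longrightarrow> (\<forall>s r. t = s @ (V, True) # r \<longrightarrow> separated b c s))"
  unfolding compatible_def by (auto simp: Cons_eq_append_conv)

lemma compatible_Cons_V: "compatible b c ((V, m) # t) \<longleftrightarrow> compatible b c t"
  unfolding compatible_def by (auto simp: Cons_eq_append_conv)

lemma last_mark:
  assumes "marks V s > 0"
  obtains s' r where "s = s' @ (V, True) # r" "marks V r = 0"
proof -
  have "(V, True) \<in> set s"
    using assms by (metis count_list_0_iff not_gr0)
  then obtain s' r where "s = s' @ (V, True) # r" "(V, True) \<notin> set r"
    by (meson split_list_last)
  then show ?thesis using that by (simp add: count_list_0_iff)
qed

text \<open>
  Compatibility lets the debt of a marked \<open>V\<close> be paid off anywhere on the way to \<open>H\<close>, whereas the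
  race asks for a balance over the whole distance.  They agree because a \<open>V\<close> that is paid off too
  early leaves the remaining deficit to a marked \<open>V\<close> further left: the leftmost violation of the
  race is a violation of compatibility.
\<close>
lemma separated_iff_wins:
  "(\<forall>s r. t = s @ (V, True) # r \<longrightarrow> separated b c s) \<longleftrightarrow> wins b c c 1 t"
proof
  assume wins: "wins b c c 1 t"
  show "\<forall>s r. t = s @ (V, True) # r \<longrightarrow> separated b c s"
  proof (intro allI impI)
    fix s r assume "t = s @ (V, True) # r"
    with wins have "reached c c s \<or> letters H s \<ge> b * (marks V s + 1)"
      unfolding wins_def by (simp add: less_Suc_eq_le)
    moreover have "s = [] @ s" by simp
    ultimately show "separated b c s"
      unfolding separated_def by blast
  qed
next
  assume sep: "\<forall>s r. t = s @ (V, True) # r \<longrightarrow> separated b c s"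
  have "reached c c s \<or> 1 + letters H s > b * (marks V s + 1)" if "t = s @ (V, True) # r" for s r
    using that
  proof (induction s arbitrary: r rule: length_induct)
    case (1 s)
    show ?case
    proof (rule ccontr)
      assume neg: "\<not> ?thesis"
      then have "\<exists>p q. s = p @ q \<and> letters H q \<ge> b * (marks V q + 1)"
        using sep 1(2) unfolding separated_def by blast
      then obtain p q where s: "s = p @ q" and q: "letters H q \<ge> b * (marks V q + 1)"
        by blast
      have le: "1 + letters H p \<le> b * marks V p"
        using neg q by (simp add: s algebra_simps)
      then have "marks V p > 0" by (cases "marks V p") auto
      then obtain p' r' where p: "p = p' @ (V, True) # r'" "marks V r' = 0"
        by (rule last_mark)
      have "t = p' @ (V, True) # (r' @ q @ (V, True) # r)" "length p' < length s"
        using 1(2) by (simp_all add: s p)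
      with 1(1) have "reached c c p' \<or> 1 + letters H p' > b * (marks V p' + 1)"
        by blast
      moreover have "\<not> reached c c p'"
        using neg reached_append[of c c p' "(V, True) # r' @ q"] by (auto simp: s p)
      ultimately show False
        using le p by (simp add: algebra_simps)
    qed
  qed
  then show "wins b c c 1 t"
    unfolding wins_def by blast
qed

text \<open>
  The closing parenthesis that brings the number of opening ones from \<open>g\<close> to zero is the one
  with index \<open>g - 1\<close> among those that the rest of the word leaves unmatched.  Credits that
  belong to matched pairs inside only shift the debt by their total, since compatible marks pay
  for themselves before their partner is met.
\<close>
lemma wins_iff_stack:
  assumes "f > 0" "g > 0" "c > 0" "compatible b c t"
  shows "wins b c f g t \<longleftrightarrow>
    length (snd (stack b c t)) < g \<or> f \<le> depth_sum (g - 1) (stack b c t)"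
  using assms(1,2,4)
proof (induction t arbitrary: f g)
  case Nil
  then show ?case by (simp add: wins_def)
next
  case (Cons a t)
  obtain z zs where st: "stack b c t = (z, zs)" by fastforce
  obtain x m where a: "a = (x, m)" by fastforce
  show ?case
  proof (cases x)
    case H
    have t: "compatible b c t"
      using Cons.prems by (simp add: a H compatible_Cons_H)
    have "zs = [] \<or> c \<le> z" if m
    proof -
      have "wins b c c 1 t"
        using Cons.prems(3) that unfolding a H compatible_Cons_H separated_iff_wins by blast
      with Cons.IH[of c 1] t assms(3) show ?thesis
        by (simp add: st depth_sum_def)
    qed
    then show ?thesis
      using Cons.IH[of "f + (if m then c else 0)" "g + 1"] Cons.prems t
      by (cases g; cases zs) (auto simp: a H wins_H st depth_sum_def)
  next
    case V
    define n where "n = (if m then b else 0)"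
    have t: "compatible b c t"
      using Cons.prems by (simp add: a V compatible_Cons_V)
    have stack: "stack b c (a # t) = (open_level ^^ n) (Suc z, zs)"
      by (simp add: a V st n_def)
    have "wins b c f g (a # t) \<longleftrightarrow> g > n \<and> wins b c (f - 1) (g - n) t"
      using Cons.prems by (auto simp: a V wins_V n_def)
    also have "\<dots> \<longleftrightarrow> g > n \<and> (length zs < g - n \<or> f \<le> depth_sum (g - n - 1) (Suc z, zs))"
      using Cons.IH[of "f - 1" "g - n"] Cons.prems t
      by (cases "f = 1") (auto simp: wins_0 st depth_sum_def)
    also have "\<dots> \<longleftrightarrow> length (snd (stack b c (a # t))) < g \<or>
        f \<le> depth_sum (g - 1) (stack b c (a # t))"
      unfolding stack length_open_level depth_sum_open_level
      using Cons.prems by auto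
    finally show ?thesis .
  qed
qed

text \<open>
  A mark can be put on a new letter at the left end precisely if this letter finds no partner, or
  if the credit in front of its partner covers the price \<open>c\<close>.
\<close>
lemma compatible_H_iff:
  assumes "c > 0"
  shows "compatible b c ((H, True) # t) \<longleftrightarrow>
     compatible b c t \<and> (snd (stack b c t) = [] \<or> c \<le> fst (stack b c t))"
  using wins_iff_stack[of c 1 c b t] assms
  unfolding compatible_Cons_H separated_iff_wins by (auto simp: depth_sum_def)

section \<open>Summation by stack operators\<close>

text \<open>
  Since compatibility of a longer word depends on the word already absorbed only through its stack,
  sums over markings can be taken one letter at a time.  Instead of weighted sets of stacks, the
  operators below transform a function of the stack: applied to \<open>k\<close> they give the function whose
  value at a stack is the weighted sum of \<open>k\<close> over the possible next stacks.
\<close>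

type_synonym 'a stack_fun = "nat \<Rightarrow> nat list \<Rightarrow> 'a"

definition push :: "'a stack_fun \<Rightarrow> 'a stack_fun" where
  "push k = (\<lambda>z zs. k 0 (z # zs))"

lemma push_apply: "push k z zs = k 0 (z # zs)"
  by (simp add: push_def)

definition bump :: "'a stack_fun \<Rightarrow> 'a stack_fun" where
  "bump k = (\<lambda>z zs. k (Suc z) zs)"

text \<open>
  Absorbing a letter \<open>H\<close>.  Each closing parenthesis carries a factor \<open>u\<close> of its own, which cancels
  the \<open>u\<^sup>-\<^sup>1\<close> of the letter matching it, so a matched \<open>H\<close> weighs \<open>1\<close> or, if marked, \<open>y = v\<^sup>c\<close>.  An
  unmatched one can be marked or not, which together gives \<open>p = (1 + v\<^sup>c) / u\<close>.
\<close>
definition pop :: "nat \<Rightarrow> 'a::field \<Rightarrow> 'a \<Rightarrow> 'a stack_fun \<Rightarrow> 'a stack_fun" where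
  "pop c y p k = (\<lambda>z zs. case zs of
      [] \<Rightarrow> p * k z []
    | z' # zs' \<Rightarrow> k (z + z') zs' + (if c \<le> z then y * k (z + z' - c) zs' else 0))"

text \<open>
  The stack absorbs \<open>w\<close> from the right, whereas its leftmost letter is the first one to act on \<open>k\<close>:
  the state before this letter has to be known as a function before earlier states are summed over.
  The two summands for \<open>V\<close> belong to its two markings.
\<close>
fun absorb :: "nat \<Rightarrow> nat \<Rightarrow> 'a::field \<Rightarrow> 'a \<Rightarrow> letter list \<Rightarrow> 'a stack_fun \<Rightarrow> 'a stack_fun" where
  "absorb b c y p [] k = k"
| "absorb b c y p (H # w) k = absorb b c y p w (pop c y p k)"
| "absorb b c y p (V # w) k = absorb b c y p w (\<lambda>z zs. bump k z zs + bump ((push ^^ b) k) z zs)"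

lemma absorb_append: "absorb b c y p (w @ w') k = absorb b c y p w' (absorb b c y p w k)"
proof (induction w arbitrary: k)
  case (Cons x w)
  then show ?case by (cases x) simp_all
qed simp

lemma open_level_push: "case_prod k ((open_level ^^ n) st) = case_prod ((push ^^ n) k) st"
proof (induction n arbitrary: k)
  case (Suc n)
  have "case_prod k ((open_level ^^ Suc n) st) = case_prod (push k) ((open_level ^^ n) st)"
    by (simp add: open_level_def push_def case_prod_beta)
  then show ?case
    by (simp add: Suc.IH funpow_swap1)
qed simp

text \<open>
  The exponent of \<open>u\<close> is lowered by the number of closing parentheses that have not been matched
  yet.  Their factors \<open>u\<close> are supplied at the end by \<open>k\<close>.
\<close>
definition marking_weight ::
    "nat \<Rightarrow> nat \<Rightarrow> 'a::field \<Rightarrow> 'a \<Rightarrow> 'a stack_fun \<Rightarrow> marking \<Rightarrow> 'a" where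
  "marking_weight b c u y k t = (if compatible b c t then
     u powi (int (b * marks V t) - int (letters H t) - int (length (snd (stack b c t)))) *
     y ^ marks H t * case_prod k (stack b c t) else 0)"

lemma marking_weight_eq:
  assumes "compatible b c t" "stack b c t = st"
    and "e = int (b * marks V t) - int (letters H t) - int (length (snd st))"
  shows "marking_weight b c u y k t = u powi e * y ^ marks H t * case_prod k st"
  using assms by (simp add: marking_weight_def)

lemma marking_weight_H:
  assumes "u \<noteq> 0" "c > 0"
  shows "marking_weight b c u y k ((H, False) # t) + marking_weight b c u y k ((H, True) # t) =
    marking_weight b c u y (pop c y ((1 + y) / u) k) t"
proof (cases "compatible b c t")
  case True
  define e where "e = int (b * marks V t) - int (letters H t)"
  obtain z zs where st: "stack b c t = (z, zs)" by fastforce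
  have False_comp: "compatible b c ((H, False) # t)"
    using True by (simp add: compatible_Cons_H)
  note True_comp = compatible_H_iff[OF assms(2), of b t]
  show ?thesis
  proof (cases zs)
    case Nil
    have "marking_weight b c u y k ((H, False) # t) = u powi (e - 1) * y ^ marks H t * k z []"
      by (subst marking_weight_eq[OF False_comp refl, of "e - 1"]) (simp_all add: e_def st Nil)
    moreover have "marking_weight b c u y k ((H, True) # t) =
        u powi (e - 1) * (y * y ^ marks H t) * k z []"
      by (subst marking_weight_eq[OF _ refl, of _ _ _ "e - 1"])
         (simp_all add: e_def st Nil True_comp True)
    moreover have "marking_weight b c u y (pop c y ((1 + y) / u) k) t =
        u powi e * y ^ marks H t * ((1 + y) / u * k z [])"
      by (subst marking_weight_eq[OF True refl, of e]) (simp_all add: e_def st Nil pop_def)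
    moreover have "u powi (e - 1) = u powi e / u"
      using assms by (simp add: power_int_diff)
    ultimately show ?thesis
      by (simp add: algebra_simps add_divide_distrib)
  next
    case (Cons z' zs')
    define e' where "e' = e - 1 - int (length zs')"
    have "marking_weight b c u y k ((H, False) # t) = u powi e' * y ^ marks H t * k (z + z') zs'"
      by (subst marking_weight_eq[OF False_comp refl, of e']) (simp_all add: e'_def e_def st Cons)
    moreover have "marking_weight b c u y k ((H, True) # t) =
        (if c \<le> z then u powi e' * (y * y ^ marks H t) * k (z + z' - c) zs' else 0)"
    proof (cases "c \<le> z")
      case le: True
      then show ?thesis
        by (subst marking_weight_eq[OF _ refl, of _ _ _ e'])
           (simp_all add: e'_def e_def st Cons True_comp True)
    next
      case False
      then show ?thesis
        by (simp add: marking_weight_def True_comp st Cons)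
    qed
    moreover have "marking_weight b c u y (pop c y ((1 + y) / u) k) t = u powi e' * y ^ marks H t *
        (k (z + z') zs' + (if c \<le> z then y * k (z + z' - c) zs' else 0))"
      by (subst marking_weight_eq[OF True refl, of e']) (simp_all add: e'_def e_def st Cons pop_def)
    ultimately show ?thesis
      by (simp add: algebra_simps)
  qed
qed (simp add: marking_weight_def compatible_Cons_H)

lemma marking_weight_V:
  "marking_weight b c u y k ((V, False) # t) + marking_weight b c u y k ((V, True) # t) =
    marking_weight b c u y (\<lambda>z zs. bump k z zs + bump ((push ^^ b) k) z zs) t"
proof (cases "compatible b c t")
  case True
  define e where
    "e = int (b * marks V t) - int (letters H t) - int (length (snd (stack b c t)))"
  obtain z zs where st: "stack b c t = (z, zs)" by fastforce
  have comp: "compatible b c ((V, m) # t)" for m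
    using True by (simp add: compatible_Cons_V)
  have "marking_weight b c u y k ((V, False) # t) = u powi e * y ^ marks H t * bump k z zs"
    by (subst marking_weight_eq[OF comp refl, of e]) (simp_all add: e_def st bump_def)
  moreover have "marking_weight b c u y k ((V, True) # t) =
      u powi e * y ^ marks H t * bump ((push ^^ b) k) z zs"
    by (subst marking_weight_eq[OF comp refl, of e])
       (simp_all add: e_def st bump_def length_open_level open_level_push algebra_simps)
  moreover have "marking_weight b c u y (\<lambda>z zs. bump k z zs + bump ((push ^^ b) k) z zs) t =
      u powi e * y ^ marks H t * (bump k z zs + bump ((push ^^ b) k) z zs)"
    by (subst marking_weight_eq[OF True refl, of e]) (simp_all add: e_def st)
  ultimately show ?thesis
    by (simp add: algebra_simps)
qed (simp add: marking_weight_def compatible_Cons_V)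

lemma sum_marking_weight:
  assumes "u \<noteq> 0" "c > 0"
  shows "(\<Sum>t\<in>markings w. marking_weight b c u y k t) = absorb b c y ((1 + y) / u) w k 0 []"
proof (induction w arbitrary: k)
  case Nil
  have "compatible b c []" by (simp add: compatible_def)
  then show ?case by (simp add: markings_Nil marking_weight_def)
next
  case (Cons x w)
  show ?case
    by (cases x) (simp_all add: sum_markings_Cons marking_weight_H[OF assms] marking_weight_V Cons.IH)
qed

lemma word_sum_absorb:
  assumes "u \<noteq> 0" "v \<noteq> 0" "c > 0"
  shows "word_sum b c u v w = v powi (- int (count_list w V)) *
    absorb b c (v ^ c) ((1 + v ^ c) / u) w (\<lambda>z zs. u ^ length zs) 0 []"
proof -
  have "word_sum b c u v w = (\<Sum>t\<in>markings w. if compatible b c t then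
      u powi (int (b * marks V t) - int (letters H t)) *
      v powi (int (c * marks H t) - int (letters V t)) else 0)"
    unfolding word_sum_def by (intro sum.mono_neutral_cong_left) (auto simp: finite_markings)
  also have "\<dots> = (\<Sum>t\<in>markings w. v powi (- int (count_list w V)) *
      marking_weight b c u (v ^ c) (\<lambda>z zs. u ^ length zs) t)"
  proof (rule sum.cong[OF refl])
    fix t assume "t \<in> markings w"
    then have w: "count_list w V = letters V t" by (simp add: markings_def)
    have u: "u powi (i - int n) * s * u ^ n = u powi i * s" for i n and s :: 'a
      using assms(1) by (simp add: power_int_diff)
    have v: "v powi (int (c * n) - int l) = v powi (- int l) * (v ^ c) ^ n" for n l
    proof -
      have "v powi (int (c * n) - int l) = v powi int (c * n) / v powi int l"
        using assms(2) by (intro power_int_diff) simp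
      then show ?thesis
        by (simp only: power_int_minus power_int_of_nat power_mult divide_inverse mult.commute)
    qed
    show "(if compatible b c t then
        u powi (int (b * marks V t) - int (letters H t)) *
        v powi (int (c * marks H t) - int (letters V t)) else 0) =
      v powi (- int (count_list w V)) * marking_weight b c u (v ^ c) (\<lambda>z zs. u ^ length zs) t"
      by (simp only: marking_weight_def case_prod_beta u v w) simp
  qed
  also have "\<dots> = v powi (- int (count_list w V)) *
      absorb b c (v ^ c) ((1 + v ^ c) / u) w (\<lambda>z zs. u ^ length zs) 0 []"
    by (simp add: sum_marking_weight[OF assms(1,3)] flip: sum_distrib_left)
  finally show ?thesis .
qed

text \<open>
  The factor \<open>H\<^bsup>n\<^esup> V\<close> without the credit given by \<open>V\<close>.  The first summand belongs to an
  unmarked \<open>V\<close>; the second one to a marked \<open>V\<close>, of whose \<open>b\<close> closing parentheses \<open>n\<close> are consumed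
  within the block.
\<close>
definition block :: "nat \<Rightarrow> nat \<Rightarrow> 'a::field \<Rightarrow> 'a \<Rightarrow> nat \<Rightarrow> 'a stack_fun \<Rightarrow> 'a stack_fun" where
  "block b c y p n k = (\<lambda>z zs. (pop c y p ^^ n) k z zs + (push ^^ (b - n)) k z zs)"

text \<open>
  A letter \<open>H\<close> directly before a closing parenthesis is matched with credit zero, hence unmarked.
\<close>
lemma push_pop: "c > 0 \<Longrightarrow> push (pop c y p k) = k"
  by (simp add: push_def pop_def)

lemma push_funpow_pop_funpow:
  assumes "c > 0" "n \<le> b"
  shows "(push ^^ b) ((pop c y p ^^ n) k) = (push ^^ (b - n)) k"
  using assms(2)
proof (induction n arbitrary: b)
  case (Suc n)
  then obtain b' where b: "b = Suc b'" by (cases b) auto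
  show ?case
    using Suc by (simp add: b funpow_swap1[of push] push_pop[OF assms(1)])
qed simp

definition word_of_blocks :: "nat list \<Rightarrow> letter list" where
  "word_of_blocks ns = concat (map (\<lambda>n. replicate n H @ [V]) ns)"

lemma absorb_replicate_H: "absorb b c y p (replicate n H) k = (pop c y p ^^ n) k"
  by (induction n arbitrary: k) (simp_all add: funpow_swap1)

lemma absorb_block:
  assumes "c > 0" "n \<le> b"
  shows "absorb b c y p (replicate n H @ [V]) k = bump (block b c y p n k)"
  by (simp add: absorb_append absorb_replicate_H push_funpow_pop_funpow[OF assms])
     (simp add: bump_def block_def)

primrec absorb_blocks ::
    "nat \<Rightarrow> nat \<Rightarrow> 'a::field \<Rightarrow> 'a \<Rightarrow> nat list \<Rightarrow> 'a stack_fun \<Rightarrow> 'a stack_fun" where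
  "absorb_blocks b c y p [] k = k"
| "absorb_blocks b c y p (n # ns) k = absorb_blocks b c y p ns (bump (block b c y p n k))"

lemma absorb_word_of_blocks:
  assumes "c > 0" "\<forall>n\<in>set ns. n \<le> b"
  shows "absorb b c y p (word_of_blocks ns) k = absorb_blocks b c y p ns k"
  using assms(2)
proof (induction ns arbitrary: k)
  case (Cons n ns)
  have "absorb b c y p (word_of_blocks (n # ns)) k =
      absorb b c y p (word_of_blocks ns) (absorb b c y p (replicate n H @ [V]) k)"
    by (simp add: word_of_blocks_def flip: absorb_append)
  with Cons show ?case
    by (simp add: absorb_block[OF assms(1)])
qed (simp add: word_of_blocks_def)

lemma absorb_blocks_snoc:
  "absorb_blocks b c y p (ns @ [n]) k = bump (block b c y p n (absorb_blocks b c y p ns k))"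
  by (induction ns arbitrary: k) simp_all

section \<open>Pairing a left stack with a right stack\<close>

text \<open>
  The left stack \<open>(x, xs)\<close> describes the unmatched opening parentheses of a left part of the word,
  the right stack \<open>(z, zs)\<close> the unmatched closing ones of the right part, both listed starting at
  the cut.  The pairing matches them from the inside, with the choice of a mark for each pair.
  Remaining opening parentheses weigh \<open>p\<close>, remaining closing ones \<open>q\<close>.
\<close>

fun pairing :: "nat \<Rightarrow> 'a::field \<Rightarrow> 'a \<Rightarrow> 'a \<Rightarrow> nat \<Rightarrow> nat list \<Rightarrow> nat \<Rightarrow> nat list \<Rightarrow> 'a" where
  "pairing c y p q x (x' # xs) z (z' # zs) =
     pairing c y p q (x' + (x + z)) xs z' zs +
     (if c \<le> x + z then y * pairing c y p q (x' + (x + z) - c) xs z' zs else 0)"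
| "pairing c y p q x [] z zs = q ^ length zs"
| "pairing c y p q x xs z [] = p ^ length xs"

lemma pairing_shift: "x + z = x' + z' \<Longrightarrow> pairing c y p q x xs z zs = pairing c y p q x' xs z' zs"
  by (cases xs; cases zs) simp_all

lemma pairing_swap: "pairing c y p q x xs z zs = pairing c y q p z zs x xs"
proof (induction c y p q x xs z zs rule: pairing.induct)
  case (1 c y p q x x' xs z z' zs)
  have "pairing c y p q (x' + (x + z)) xs z' zs = pairing c y q p (z' + (z + x)) zs x' xs"
    unfolding 1(1) by (rule pairing_shift) simp
  moreover have "pairing c y p q (x' + (x + z) - c) xs z' zs =
      pairing c y q p (z' + (z + x) - c) zs x' xs" if "c \<le> x + z"
    unfolding 1(2)[OF that] using that by (intro pairing_shift) simp
  ultimately show ?case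
    by (simp add: add.commute[of z x])
next
  case (2 c y p q x z zs)
  then show ?case by (cases zs) simp_all
qed simp

text \<open>
  An opening parenthesis next to the cut may be handed to either side: matched at once with the
  right stack, or put on the left one.
\<close>
lemma pop_pairing: "pop c y p (pairing c y p q x xs) = pairing c y p q 0 (x # xs)"
proof (intro ext)
  fix z zs
  show "pop c y p (pairing c y p q x xs) z zs = pairing c y p q 0 (x # xs) z zs"
  proof (cases zs)
    case (Cons z' zs')
    have "pairing c y p q x xs (z + z') zs' = pairing c y p q (x + z) xs z' zs'"
      by (rule pairing_shift) simp
    moreover have "pairing c y p q x xs (z + z' - c) zs' = pairing c y p q (x + z - c) xs z' zs'"
      if "c \<le> z"
      using that by (intro pairing_shift) simp
    ultimately show ?thesis
      by (simp add: pop_def Cons)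
  qed (cases xs; simp add: pop_def)
qed

lemma pop_funpow_pairing:
  "(pop c y p ^^ n) (pairing c y p q x xs) z zs =
     (push ^^ n) (\<lambda>x xs. pairing c y p q x xs z zs) x xs"
proof (induction n arbitrary: x xs)
  case (Suc n)
  have "(pop c y p ^^ Suc n) (pairing c y p q x xs) z zs =
      (pop c y p ^^ n) (pairing c y p q 0 (x # xs)) z zs"
    by (simp only: funpow_Suc_right comp_def pop_pairing)
  also have "\<dots> = push ((push ^^ n) (\<lambda>x xs. pairing c y p q x xs z zs)) x xs"
    by (subst Suc.IH) (rule push_apply[symmetric])
  finally show ?case by simp
qed simp

lemma push_funpow_pairing:
  "(push ^^ n) (pairing c y p q x xs) z zs =
     (pop c y q ^^ n) (\<lambda>x xs. pairing c y p q x xs z zs) x xs"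
proof -
  have "(\<lambda>x xs. pairing c y p q x xs z zs) = pairing c y q p z zs"
    "pairing c y p q x xs = (\<lambda>z zs. pairing c y q p z zs x xs)"
    by (auto intro!: ext pairing_swap)
  then show ?thesis
    by (simp add: pop_funpow_pairing)
qed

text \<open>
  The crucial duality: a block \<open>H\<^bsup>n\<^esup> V\<close> acting on the right stack is a block \<open>H\<^bsup>b-n\<^esup> V\<close> acting on
  the left stack, with the alternatives of a marked and of an unmarked \<open>V\<close> exchanged.
\<close>
lemma block_pairing:
  assumes "n \<le> b"
  shows "block b c y p n (pairing c y p q x xs) z zs =
    block b c y q (b - n) (\<lambda>x xs. pairing c y p q x xs z zs) x xs"
  using assms by (simp add: block_def pop_funpow_pairing push_funpow_pairing)

section \<open>Linearity\<close>

text \<open>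
  Operators on the left stack and operators on the right stack commute.  For this it suffices that
  one of them is linear, because the other one forms finite linear combinations.
\<close>

definition stack_linear :: "('a::field stack_fun \<Rightarrow> 'a) \<Rightarrow> bool" where
  "stack_linear A \<longleftrightarrow> (\<forall>k l. A (\<lambda>z zs. k z zs + l z zs) = A k + A l) \<and>
     (\<forall>a k. A (\<lambda>z zs. a * k z zs) = a * A k)"

lemma stack_linear_pop:
  assumes "stack_linear A"
  shows "A (\<lambda>z zs. (pop c y p ^^ n) (\<lambda>x xs. f x xs z zs) x xs) =
    (pop c y p ^^ n) (\<lambda>x xs. A (f x xs)) x xs"
proof (induction n arbitrary: x xs)
  case (Suc n)
  define g where "g x xs = (\<lambda>z zs. (pop c y p ^^ n) (\<lambda>x xs. f x xs z zs) x xs)" for x xs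
  have "A (\<lambda>z zs. pop c y p (\<lambda>x xs. g x xs z zs) x xs) = pop c y p (\<lambda>x xs. A (g x xs)) x xs"
    using assms by (cases xs; cases "c \<le> x") (simp_all add: pop_def stack_linear_def)
  then show ?case
    using Suc.IH by (simp add: g_def)
qed simp

lemma push_funpow_commute:
  "A (\<lambda>z zs. (push ^^ n) (\<lambda>x xs. f x xs z zs) x xs) = (push ^^ n) (\<lambda>x xs. A (f x xs)) x xs"
  by (induction n arbitrary: x xs) (simp_all add: push_def)

lemma stack_linear_block:
  assumes "stack_linear A"
  shows "A (\<lambda>z zs. block b c y p n (\<lambda>x xs. f x xs z zs) x xs) =
    block b c y p n (\<lambda>x xs. A (f x xs)) x xs"
  using assms stack_linear_pop[OF assms, where f = f] push_funpow_commute[where A = A and f = f]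
  by (simp add: block_def stack_linear_def)

lemma pop_funpow_linear:
  "(pop c y p ^^ n) (\<lambda>z zs. k z zs + l z zs) =
     (\<lambda>z zs. (pop c y p ^^ n) k z zs + (pop c y p ^^ n) l z zs)"
  "(pop c y p ^^ n) (\<lambda>z zs. a * k z zs) = (\<lambda>z zs. a * (pop c y p ^^ n) k z zs)"
proof -
  show "(pop c y p ^^ n) (\<lambda>z zs. k z zs + l z zs) =
      (\<lambda>z zs. (pop c y p ^^ n) k z zs + (pop c y p ^^ n) l z zs)"
    by (induction n) (auto simp: pop_def fun_eq_iff algebra_simps split: list.split)
  show "(pop c y p ^^ n) (\<lambda>z zs. a * k z zs) = (\<lambda>z zs. a * (pop c y p ^^ n) k z zs)"
    by (induction n) (auto simp: pop_def fun_eq_iff algebra_simps split: list.split)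
qed

lemma push_funpow_linear:
  "(push ^^ n) (\<lambda>z zs. k z zs + l z zs) = (\<lambda>z zs. (push ^^ n) k z zs + (push ^^ n) l z zs)"
  "(push ^^ n) (\<lambda>z zs. a * k z zs) = (\<lambda>z zs. a * (push ^^ n) k z zs)" for a :: "'a::field"
  by (induction n) (simp_all add: push_def)

lemma stack_linear_block_eval: "stack_linear (\<lambda>k. block b c y p n k z zs)"
  by (simp add: stack_linear_def block_def pop_funpow_linear push_funpow_linear algebra_simps)

lemma stack_linear_absorb_blocks: "stack_linear (\<lambda>k. absorb_blocks b c y p ns k z zs)"
proof (induction ns)
  case Nil
  then show ?case by (simp add: stack_linear_def)
next
  case (Cons n ns)
  have "bump (block b c y p n (\<lambda>z zs. k z zs + l z zs)) =
      (\<lambda>z zs. bump (block b c y p n k) z zs + bump (block b c y p n l) z zs)"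
    "bump (block b c y p n (\<lambda>z zs. a * k z zs)) =
      (\<lambda>z zs. a * bump (block b c y p n k) z zs)" for k l a
    using stack_linear_block_eval[of b c y p n] by (auto simp: stack_linear_def bump_def fun_eq_iff)
  with Cons show ?case
    by (simp add: stack_linear_def)
qed

section \<open>Mutation\<close>

text \<open>
  This absorbs the blocks into the left stack, from left to right.  The credit of each \<open>V\<close> is
  added after its parentheses, that is, on the same side of them as in the word itself.
\<close>
primrec absorb_blocks_left ::
    "nat \<Rightarrow> nat \<Rightarrow> 'a::field \<Rightarrow> 'a \<Rightarrow> nat list \<Rightarrow> 'a stack_fun \<Rightarrow> 'a stack_fun" where
  "absorb_blocks_left b c y q [] k = k"
| "absorb_blocks_left b c y q (n # ns) k =
     block b c y q (b - n) (bump (absorb_blocks_left b c y q ns k))"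

text \<open>
  The blocks are moved across the cut one after the other, by \<open>block_pairing\<close>.
\<close>
lemma absorb_blocks_pairing:
  assumes "\<forall>n\<in>set ns. n \<le> b"
  shows "absorb_blocks b c y p ns (pairing c y p q x xs) z zs =
    absorb_blocks_left b c y q ns (\<lambda>x xs. pairing c y p q x xs z zs) x xs"
  using assms
proof (induction ns arbitrary: x xs)
  case (Cons n ns)
  have "bump (block b c y p n (pairing c y p q x xs)) = (\<lambda>z zs.
      block b c y q (b - n) (\<lambda>x xs. pairing c y p q (Suc x) xs z zs) x xs)"
  proof (intro ext)
    fix z zs
    have "(\<lambda>x xs. pairing c y p q x xs (Suc z) zs) = (\<lambda>x xs. pairing c y p q (Suc x) xs z zs)"
      by (intro ext pairing_shift) simp
    then show "bump (block b c y p n (pairing c y p q x xs)) z zs =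
        block b c y q (b - n) (\<lambda>x xs. pairing c y p q (Suc x) xs z zs) x xs"
      using Cons.prems by (simp add: bump_def block_pairing)
  qed
  then have "absorb_blocks b c y p (n # ns) (pairing c y p q x xs) z zs =
      block b c y q (b - n) (\<lambda>x xs. absorb_blocks b c y p ns (pairing c y p q (Suc x) xs) z zs) x xs"
    by (simp add: stack_linear_block[OF stack_linear_absorb_blocks])
  also have "\<dots> = absorb_blocks_left b c y q (n # ns) (\<lambda>x xs. pairing c y p q x xs z zs) x xs"
    using Cons by (simp add: bump_def)
  finally show ?case .
qed simp

lemma bump_absorb_blocks_left:
  "bump (absorb_blocks_left b c y q ns k) =
     absorb_blocks b c y q (rev (map (\<lambda>n. b - n) ns)) (bump k)"
  by (induction ns) (simp_all add: absorb_blocks_snoc)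

text \<open>
  The word read from its other end collects the credit of each \<open>V\<close> before the parentheses of its
  block instead of after them.  The two arrangements differ only by the credits at the two ends of
  the word, which never count because they lie outside all matched pairs.  This is why
  \<open>absorb_blocks_pairing\<close> is applied to the left stack \<open>(1, [])\<close>, which pairs like \<open>(0, [])\<close>.
\<close>
lemma absorb_blocks_reverse:
  assumes "\<forall>n\<in>set ns. n \<le> b"
  shows "absorb_blocks b c y p ns (\<lambda>z zs. q ^ length zs) 0 [] =
    absorb_blocks b c y q (rev (map (\<lambda>n. b - n) ns)) (\<lambda>z zs. p ^ length zs) 0 []"
proof -
  have left: "pairing c y p q x [] = (\<lambda>z zs. q ^ length zs)" for x
    by (intro ext) simp
  have right: "(\<lambda>x xs. pairing c y p q x xs 0 []) = (\<lambda>x xs. p ^ length xs)"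
  proof (intro ext)
    show "pairing c y p q x xs 0 [] = p ^ length xs" for x xs
      by (cases xs) simp_all
  qed
  have "absorb_blocks b c y p ns (\<lambda>z zs. q ^ length zs) 0 [] =
      bump (absorb_blocks_left b c y q ns (\<lambda>x xs. p ^ length xs)) 0 []"
    using absorb_blocks_pairing[OF assms, of c y p q 1 "[]" 0 "[]"]
    by (simp add: left right bump_def)
  then show ?thesis
    by (simp add: bump_absorb_blocks_left) (simp add: bump_def)
qed

lemma count_word_of_blocks: "count_list (word_of_blocks ns) V = length ns"
  by (induction ns) (simp_all add: word_of_blocks_def)

text \<open>
  The weights of the unmatched parentheses are \<open>p = (1 + v\<^sup>c) / u = u'\<close> and \<open>q = u\<close>; for \<open>u'\<close> in
  place of \<open>u\<close> they are exchanged.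
\<close>
lemma word_sum_blocks:
  assumes "u \<noteq> 0" "u' \<noteq> 0" "v \<noteq> 0" "c > 0" "u * u' = v ^ c + 1" "\<forall>n\<in>set ns. n \<le> b"
  shows "word_sum b c u v (word_of_blocks ns) =
    word_sum b c u' v (word_of_blocks (rev (map (\<lambda>n. b - n) ns)))"
proof -
  have "(1 + v ^ c) / u = u'" "(1 + v ^ c) / u' = u"
    using assms(1,2,5) by (simp_all add: field_simps)
  moreover have "\<forall>n\<in>set (rev (map (\<lambda>n. b - n) ns)). n \<le> b" by auto
  ultimately show ?thesis
    using absorb_blocks_reverse[OF assms(6), of c "v ^ c" u' u] assms
    by (simp add: word_sum_absorb absorb_word_of_blocks count_word_of_blocks)
qed

definition word_of_runs :: "nat list \<Rightarrow> letter list" where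
  "word_of_runs ls = concat (map (\<lambda>l. H # replicate l V) ls)"

lemma flip_word_of_runs: "rev (map other (word_of_runs ls)) = word_of_blocks (rev ls)"
  by (induction ls) (simp_all add: word_of_runs_def word_of_blocks_def)

lemma word_sum_mutation:
  assumes "u \<noteq> 0" "u' \<noteq> 0" "v \<noteq> 0" "c > 0" "u * u' = v ^ c + 1" "\<forall>l\<in>set ls. l \<le> b"
  shows "word_sum c b v u' (word_of_runs ls) =
    word_sum b c u v (word_of_blocks (map (\<lambda>l. b - l) ls))"
proof -
  have "word_sum c b v u' (word_of_runs ls) = word_sum b c u' v (word_of_blocks (rev ls))"
    by (subst word_sum_flip) (simp add: flip_word_of_runs)
  also have "\<dots> = word_sum b c u v (word_of_blocks (map (\<lambda>l. b - l) ls))"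
    using word_sum_blocks[of u' u v c "rev ls" b] assms by (simp add: mult.commute rev_map)
  finally show ?thesis .
qed

lemma word_sum_H:
  assumes "v \<noteq> 0"
  shows "word_sum b c u v [H] = (v ^ c + 1) / u"
proof -
  have "{t. t \<in> markings [H] \<and> compatible b c t} = {[(H, False)], [(H, True)]}"
    by (auto simp: markings_Cons markings_Nil compatible_def Cons_eq_append_conv)
  then show ?thesis
    by (simp add: word_sum_def field_simps power_int_minus add_divide_distrib)
qed

text \<open>
  Together with \<open>word_sum_H\<close>: the two words of length one give the two neighbours of the cluster.
\<close>
lemma word_sum_V:
  assumes "u \<noteq> 0"
  shows "word_sum b c u v [V] = (u ^ b + 1) / v"
  using word_sum_H[OF assms, of c b v] by (simp add: word_sum_flip[of b c u v "[V]"])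

section \<open>Families of words closed under mutation\<close>

text \<open>
  Mutation with exponent \<open>d\<close> takes \<open>W\<close> to \<open>W'\<close>, except for the word \<open>V\<close>, whose sum is known.
\<close>
definition mutation_closed :: "nat \<Rightarrow> letter list set \<Rightarrow> letter list set \<Rightarrow> bool" where
  "mutation_closed d W W' \<longleftrightarrow> (\<forall>w\<in>W. w = [V] \<or>
     (\<exists>ls. w = word_of_runs ls \<and> (\<forall>l\<in>set ls. l \<le> d) \<and>
        word_of_blocks (map (\<lambda>l. d - l) ls) \<in> W'))"

lemma mutation_closedI:
  assumes "\<And>ls l. ls \<in> L \<Longrightarrow> l \<in> set ls \<Longrightarrow> l \<le> d"
    and "\<And>ls. ls \<in> L \<Longrightarrow> word_of_blocks (map (\<lambda>l. d - l) ls) \<in> W'"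
  shows "mutation_closed d (insert [V] (word_of_runs ` L)) W'"
  using assms unfolding mutation_closed_def by blast

lemma word_of_blocks_eq_runs:
  "\<forall>n\<in>set ns. n > 0 \<Longrightarrow>
     word_of_blocks ns = word_of_runs (concat (map (\<lambda>n. replicate (n - 1) 0 @ [1]) ns))"
proof (induction ns)
  case (Cons n ns)
  have *: "replicate k H = word_of_runs (replicate k 0)" for k
    by (induction k) (simp_all add: word_of_runs_def)
  from Cons.prems obtain k where "n = Suc k" by (cases n) auto
  then have "replicate n H @ [V] = word_of_runs (replicate (n - 1) 0 @ [1])"
    using *[of k] by (simp add: word_of_runs_def replicate_append_same flip: append_Cons)
  with Cons show ?case
    by (simp add: word_of_blocks_def word_of_runs_def)
qed (simp add: word_of_blocks_def word_of_runs_def)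

lemma word_of_runs_0: "word_of_runs [0] = [H]"
  by (simp add: word_of_runs_def)

text \<open>
  If both exponents are at least 2, runs of \<open>V\<close> of length at most 1 become nonempty runs of \<open>H\<close>,
  so that no two letters \<open>V\<close> are adjacent in the new word either.
\<close>
lemma closed_family_ge_2:
  assumes "b \<ge> 2" "d \<ge> 2"
  shows "\<exists>W W'. [H] \<in> W \<and> [H] \<in> W' \<and> mutation_closed b W W' \<and> mutation_closed d W' W"
proof -
  define L where "L = {ls::nat list. set ls \<subseteq> {0, 1}}"
  define W where "W = insert [V] (word_of_runs ` L)"
  have "[0] \<in> L" by (simp add: L_def)
  then have "[H] \<in> W"
    unfolding W_def word_of_runs_0[symmetric] by blast
  moreover have "mutation_closed e W W" if "e \<ge> 2" for e
    unfolding W_def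
  proof (rule mutation_closedI)
    fix ls assume "ls \<in> L"
    then have ls: "set ls \<subseteq> {0, 1}" by (simp add: L_def)
    then show "l \<le> e" if "l \<in> set ls" for l
      using that \<open>e \<ge> 2\<close> by auto
    have "word_of_blocks (map (\<lambda>l. e - l) ls) =
        word_of_runs (concat (map (\<lambda>n. replicate (n - 1) 0 @ [1]) (map (\<lambda>l. e - l) ls)))"
      using ls that by (intro word_of_blocks_eq_runs) auto
    moreover have "concat (map (\<lambda>n. replicate (n - 1) 0 @ [1]) (map (\<lambda>l. e - l) ls)) \<in> L"
      by (auto simp: L_def)
    ultimately show "word_of_blocks (map (\<lambda>l. e - l) ls) \<in> insert [V] (word_of_runs ` L)"
      by simp
  qed
  ultimately show ?thesis
    using assms by blast
qed

text \<open>
  The effect of mutation with exponent 1 on a block: \<open>H\<^bsup>n\<^esup> V\<close> becomes \<open>(H V)\<^bsup>n-1\<^esup> V\<close>.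
\<close>
lemma word_of_blocks_complement:
  "\<forall>n\<in>set ns. n \<ge> 2 \<Longrightarrow>
   word_of_blocks (map (\<lambda>l. 1 - l) (concat (map (\<lambda>n. replicate (n - 1) 0 @ [1]) ns))) =
   word_of_runs (concat (map (\<lambda>n. replicate (n - 2) 1 @ [2]) ns))"
proof (induction ns)
  case (Cons n ns)
  have *: "word_of_blocks (replicate k 1) = word_of_runs (replicate k 1)" for k
    by (induction k) (simp_all add: word_of_runs_def word_of_blocks_def)
  from Cons.prems obtain k where n: "n = k + 2"
    by (auto simp: nat_le_iff_add add.commute)
  have "map (\<lambda>l. 1 - l) (replicate (n - 1) 0 @ [1]) = replicate k 1 @ [1, 0::nat]"
    unfolding n by (induction k) simp_all
  then have "word_of_blocks (map (\<lambda>l. 1 - l) (replicate (n - 1) 0 @ [1])) =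
      word_of_blocks (replicate k 1) @ [H, V, V]"
    by (simp add: word_of_blocks_def)
  also have "\<dots> = word_of_runs (replicate (n - 2) 1 @ [2])"
    unfolding * by (simp add: n word_of_runs_def numeral_2_eq_2)
  finally show ?case
    using Cons by (simp add: word_of_blocks_def word_of_runs_def)
qed (simp add: word_of_blocks_def word_of_runs_def)

text \<open>
  When one exponent is 1, words alternate between two shapes: runs of \<open>V\<close> of length at most 2, and
  runs of \<open>H\<close> of length at least 2.  Mutation with exponent \<open>b\<close> leads from the first shape to the
  second because \<open>b - 2 \<ge> 2\<close>.  The starting word \<open>H\<close> has to be added to the second shape.
\<close>
lemma closed_family_ge_4:
  assumes "b \<ge> 4"
  shows "\<exists>W W'. [H] \<in> W \<and> [H] \<in> W' \<and> mutation_closed b W W' \<and> mutation_closed 1 W' W"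
proof -
  define N where "N = {ns::nat list. \<forall>n\<in>set ns. n \<ge> 2}"
  define W where "W = insert [V] (word_of_runs ` {ls. set ls \<subseteq> {0, 1, 2}})"
  define W' where "W' = insert [H] (word_of_blocks ` N)"
  have "mutation_closed b W W'"
    unfolding W_def
  proof (rule mutation_closedI)
    fix ls assume "ls \<in> {ls. set ls \<subseteq> {0, 1, 2::nat}}"
    then have ls: "l \<le> 2" if "l \<in> set ls" for l
      using that by auto
    show "l \<le> b" if "l \<in> set ls" for l
      using ls[OF that] assms by linarith
    have "map (\<lambda>l. b - l) ls \<in> N"
      using assms by (auto simp: N_def dest!: ls)
    then show "word_of_blocks (map (\<lambda>l. b - l) ls) \<in> W'"
      unfolding W'_def by blast
  qed
  moreover have "mutation_closed 1 W' W"
    unfolding mutation_closed_def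
  proof (intro ballI disjI2)
    fix w assume "w \<in> W'"
    then consider "w = [H]" | ns where "ns \<in> N" "w = word_of_blocks ns"
      by (auto simp: W'_def)
    then show "\<exists>ls. w = word_of_runs ls \<and> (\<forall>l\<in>set ls. l \<le> 1) \<and>
        word_of_blocks (map (\<lambda>l. 1 - l) ls) \<in> W"
    proof cases
      case 1
      have "word_of_blocks (map (\<lambda>l. 1 - l) [0]) = word_of_runs [1]"
        by (simp add: word_of_blocks_def word_of_runs_def)
      also have "\<dots> \<in> W"
        unfolding W_def by (intro insertI2 imageI) simp
      finally show ?thesis
        using 1 by (intro exI[of _ "[0]"] conjI) (simp_all add: word_of_runs_0)
    next
      case 2
      let ?ls = "concat (map (\<lambda>n. replicate (n - 1) 0 @ [1]) ns)"
      have "w = word_of_runs ?ls"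
        unfolding 2 using 2(1) by (intro word_of_blocks_eq_runs) (auto simp: N_def)
      moreover have "word_of_blocks (map (\<lambda>l. 1 - l) ?ls) =
          word_of_runs (concat (map (\<lambda>n. replicate (n - 2) 1 @ [2]) ns))"
        using 2(1) by (intro word_of_blocks_complement) (auto simp: N_def)
      moreover have "word_of_runs (concat (map (\<lambda>n. replicate (n - 2) 1 @ [2]) ns)) \<in> W"
        unfolding W_def by (intro insertI2 imageI) auto
      moreover have "\<forall>l\<in>set ?ls. l \<le> (1::nat)"
        by auto
      ultimately show ?thesis
        by metis
    qed
  qed
  moreover have "[H] \<in> W"
    unfolding W_def word_of_runs_0[symmetric] by (intro insertI2 imageI) simp
  moreover have "[H] \<in> W'"
    by (simp add: W'_def)
  ultimately show ?thesis
    by blast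
qed

text \<open>
  These are the cluster types \<open>A\<^sub>2\<close>, \<open>B\<^sub>2\<close> and \<open>G\<^sub>2\<close>.  The finitely many words are found by mutating
  \<open>H\<close> until \<open>V\<close> appears.
\<close>
lemma closed_family_finite_type:
  assumes "b \<in> {1, 2, 3}"
  shows "\<exists>W W'. [H] \<in> W \<and> [H] \<in> W' \<and> mutation_closed b W W' \<and> mutation_closed 1 W' W"
proof -
  have fam: ?thesis if "[0] \<in> L" "[0] \<in> L'"
    "\<And>ls. ls \<in> L \<Longrightarrow> (\<forall>l\<in>set ls. l \<le> b) \<and>
       word_of_blocks (map (\<lambda>l. b - l) ls) \<in> insert [V] (word_of_runs ` L')"
    "\<And>ls. ls \<in> L' \<Longrightarrow> (\<forall>l\<in>set ls. l \<le> 1) \<and>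
       word_of_blocks (map (\<lambda>l. 1 - l) ls) \<in> insert [V] (word_of_runs ` L)" for L L'
  proof (intro exI conjI)
    show "[H] \<in> insert [V] (word_of_runs ` L)" "[H] \<in> insert [V] (word_of_runs ` L')"
      using that(1,2) unfolding word_of_runs_0[symmetric] by blast+
    show "mutation_closed b (insert [V] (word_of_runs ` L)) (insert [V] (word_of_runs ` L'))"
      "mutation_closed 1 (insert [V] (word_of_runs ` L')) (insert [V] (word_of_runs ` L))"
      using that(3,4) by (blast intro!: mutation_closedI)+
  qed
  consider "b = 1" | "b = 2" | "b = 3" using assms by blast
  then show ?thesis
  proof cases
    case 1
    show ?thesis
      by (rule fam[of "{[0], [1]}" "{[0], [1]}"])
         (auto simp: 1 word_of_blocks_def word_of_runs_def)
  next
    case 2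
    show ?thesis
      by (rule fam[of "{[0], [1], [2]}" "{[0], [1], [0, 1]}"])
         (auto simp: 2 word_of_blocks_def word_of_runs_def numeral_eq_Suc)
  next
    case 3
    show ?thesis
      by (rule fam[of "{[0], [1], [2], [3], [1, 2]}" "{[0], [1], [0, 1], [0, 0, 1], [0, 1, 1]}"])
         (auto simp: 3 word_of_blocks_def word_of_runs_def numeral_eq_Suc)
  qed
qed

lemma ex_closed_family:
  assumes "b > 0" "d > 0"
  shows "\<exists>W W'. [H] \<in> W \<and> [H] \<in> W' \<and> mutation_closed b W W' \<and> mutation_closed d W' W"
proof -
  have one: "\<exists>W W'. [H] \<in> W \<and> [H] \<in> W' \<and> mutation_closed e W W' \<and> mutation_closed 1 W' W"
    if "e > 0" for e
  proof (cases "e \<ge> 4")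
    case False
    then have "e \<in> {1, 2, 3}" using that by auto
    then show ?thesis by (rule closed_family_finite_type)
  qed (rule closed_family_ge_4)
  consider "d = 1" | "b = 1" | "b \<ge> 2" "d \<ge> 2" using assms by linarith
  then show ?thesis
    using one[of b] one[of d] assms closed_family_ge_2[of b d] by cases blast+
qed

section \<open>Cluster variables\<close>

text \<open>
  Let \<open>P n\<close> consist of the two members of the cluster \<open>(y\<^sub>n, y\<^bsub>n+1\<^esub>)\<close> and of all word sums in it for
  a family closed under mutation.  These sets decrease with growing \<open>n\<close>, hence \<open>y\<^sub>n\<close>
  belongs to \<open>P 0\<close>.
\<close>
lemma range_subfree_laurent:
  fixes y :: "nat \<Rightarrow> ratfun2"
  assumes "b > 0" "c > 0" and nz: "\<And>n. y n \<noteq> 0"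
    and rec: "\<And>n. y n * y (n + 2) = y (n + 1) ^ (if even n then c else b) + 1"
  shows "y n \<in> subfree_laurent (y 0) (y 1)"
proof -
  obtain W W' where W: "[H] \<in> W" "[H] \<in> W'" "mutation_closed b W W'" "mutation_closed c W' W"
    using ex_closed_family[OF assms(1,2)] by blast
  define e where "e n = (if even n then b else c)" for n :: nat
  define F where "F n = (if even n then W' else W)" for n :: nat
  have e_pos: "e n > 0" and H: "[H] \<in> F n" and closed: "mutation_closed (e n) (F (Suc n)) (F n)"
    and e_SS: "e (Suc (Suc n)) = e n" for n
    using W assms by (simp_all add: e_def F_def)
  have rec: "y n * y (Suc (Suc n)) = y (Suc n) ^ e (Suc n) + 1" for n
    using rec[of n] by (simp add: e_def)
  define P where "P n = {y n, y (Suc n)} \<union>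
      word_sum (e n) (e (Suc n)) (y n) (y (Suc n)) ` F n" for n
  have step: "P (Suc n) \<subseteq> P n" for n
  proof -
    have "word_sum (e n) (e (Suc n)) (y n) (y (Suc n)) [H] = y (Suc (Suc n))"
      using rec[of n] nz by (simp add: word_sum_H field_simps)
    then have "y (Suc (Suc n)) \<in> P n"
      using H[of n] unfolding P_def by (metis UnI2 imageI)
    moreover have "word_sum (e (Suc n)) (e (Suc (Suc n))) (y (Suc n)) (y (Suc (Suc n))) w \<in> P n"
      if "w \<in> F (Suc n)" for w
    proof (cases "w = [V]")
      case True
      have "word_sum (e (Suc n)) (e n) (y (Suc n)) (y (Suc (Suc n))) [V] = y n"
        using rec[of n] nz by (simp add: word_sum_V field_simps)
      then show ?thesis by (simp add: True P_def e_SS)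
    next
      case False
      then obtain ls where ls: "w = word_of_runs ls" "\<forall>l\<in>set ls. l \<le> e n"
        "word_of_blocks (map (\<lambda>l. e n - l) ls) \<in> F n"
        using closed[of n] \<open>w \<in> F (Suc n)\<close> unfolding mutation_closed_def by blast
      show ?thesis
        unfolding ls(1) e_SS
        using word_sum_mutation[OF nz[of n] nz[of "Suc (Suc n)"] nz[of "Suc n"] e_pos rec ls(2)] ls(3)
        unfolding P_def by auto
    qed
    ultimately show ?thesis
      unfolding P_def[of "Suc n"] by (auto simp: P_def[of n])
  qed
  have "y n \<in> P n" by (simp add: P_def)
  moreover have "P n \<subseteq> P 0"
    by (induction n) (use step in auto)
  ultimately have "y n \<in> P 0" by blast
  moreover have "y 0 \<in> subfree_laurent (y 0) (y 1)" "y 1 \<in> subfree_laurent (y 0) (y 1)"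
    using subfree_laurent_monomials[of "{()}" "y 0" "\<lambda>_. 1" "y 1" "\<lambda>_. 0"]
      subfree_laurent_monomials[of "{()}" "y 0" "\<lambda>_. 0" "y 1" "\<lambda>_. 1"] by simp_all
  ultimately show ?thesis
    by (auto simp: P_def word_sum_subfree)
qed

lemma subfree_laurent_commute: "subfree_laurent u v \<subseteq> subfree_laurent v u"
proof
  fix f assume "f \<in> subfree_laurent u v"
  then obtain S a where S: "finite S" "f = (\<Sum>(p, q)\<in>S. of_nat (a p q) * (u powi p * v powi q))"
    unfolding subfree_laurent_def by blast
  then have "f = (\<Sum>(q, p)\<in>prod.swap ` S. of_nat (a p q) * (v powi q * u powi p))"
    by (simp add: sum.reindex case_prod_beta mult.commute[of "u powi _"])
  with S(1) show "f \<in> subfree_laurent v u"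
    unfolding subfree_laurent_def
    by (intro CollectI exI[of _ "prod.swap ` S"] exI[of _ "\<lambda>q p. a p q"]) simp
qed

theorem theorem8:
  fixes b c :: nat and x :: "int \<Rightarrow> ratfun2" and m :: int
  assumes "b > 0" and "c > 0"
    and "cluster_variables b c x"
  shows "range x \<subseteq> subfree_laurent (x m) (x (m + 1))"
proof
  define e where "e k = (if odd k then b else c)" for k :: int
  have e: "e k > 0" for k
    using assms by (simp add: e_def)
  have nz: "x k \<noteq> 0" for k
    using cluster_variables_pos[OF assms(3), of k] by simp
  have rec: "x (k - 1) * x (k + 1) = x k ^ e k + 1" for k
    using assms(3) by (simp add: cluster_variables_def e_def)
  fix f assume "f \<in> range x"
  then obtain k where f: "f = x k" by blast
  show "f \<in> subfree_laurent (x m) (x (m + 1))"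
  proof (cases "k \<ge> m")
    case True
    have "x (m + int n) * x (m + int (n + 2)) =
        x (m + int (n + 1)) ^ (if even n then e (m + 1) else e m) + 1" for n
      using rec[of "m + int (n + 1)"] by (simp add: e_def algebra_simps)
    from range_subfree_laurent[of "e m" "e (m + 1)" "\<lambda>n. x (m + int n)", OF e e nz this,
        of "nat (k - m)"] True
    show ?thesis by (simp add: f)
  next
    case False
    have "x (m + 1 - int n) * x (m + 1 - int (n + 2)) =
        x (m + 1 - int (n + 1)) ^ (if even n then e m else e (m + 1)) + 1" for n
      using rec[of "m + 1 - int (n + 1)"] by (simp add: e_def algebra_simps)
    from range_subfree_laurent[of "e (m + 1)" "e m" "\<lambda>n. x (m + 1 - int n)", OF e e nz this,
        of "nat (m + 1 - k)"] False
    have "f \<in> subfree_laurent (x (m + 1)) (x m)" by (simp add: f)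
    then show ?thesis using subfree_laurent_commute by blast
  qed
qed

end
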